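(* Let $P$ be a quantum property of bipartite states in $\mathcal{D}(\mathcal{H})$, let $\mathscr{C}\subseteq\mathcal{D}(\mathcal{H})$ be the set of all states that lack $P$, let $\widehat{A}$ be an observable on $\mathcal{H}$, let $A'\in\mathbb{R}$, and let $$S_{\max,\mathscr{C},A'} := \max_{\rho\in\mathscr{C},\ \operatorname{Tr}[\rho\widehat{A}]=A'} S(\rho).$$ If a bipartite state $\xi\in\mathcal{D}(\mathcal{H})$ satisfies both $\operatorname{Tr}[\xi\widehat{A}]=A'$ and $Z^{\mathrm{PW}}_{A'}>0$, where $$Z^{\mathrm{PW}}_{A'} := S(\xi)-S_{\max,\mathscr{C},A'},$$ then $\xi$ has the property $P$.
   Context: $\mathcal{D}(\mathcal{H})$ is the set of density operators on the finite-dimensional Hilbert space $\mathcal{H}=\mathcal{H}_A\otimes\mathcal{H}_B$ of a bipartite system. A property $P$ is identified with a partition of $\mathcal{D}(\mathcal{H})$ into the set $\mathscr{C}$ of states lacking $P$ and its complement of states having $P$. $S(\rho)=-\operatorname{Tr}[\rho\log_2\rho]$ is the von Neumann entropy. An observable is a Hermitian operator; the maximum defining $S_{\max,\mathscr{C},A'}$ is assumed to exist. *)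

theory Defs
  imports "HOL-Analysis.Analysis"
begin

text \<open>
  Operators on a finite-dimensional Hilbert space are represented by their matrices in an
  orthonormal basis indexed by \<open>'n\<close>. For a bipartite system the index type is \<open>'a \<times> 'b\<close>, that is,
  operators on $H_A \otimes H_B$ are taken in a product basis.
\<close>

definition cinner :: "complex^'n \<Rightarrow> complex^'n \<Rightarrow> complex"
  where "cinner v w = (\<Sum>i\<in>UNIV. cnj (v $ i) * w $ i)"

definition cadjoint :: "complex^'n^'m \<Rightarrow> complex^'m^'n"
  where "cadjoint A = (\<chi> i j. cnj (A $ j $ i))"

definition hermitian :: "complex^'n^'n \<Rightarrow> bool"
  where "hermitian A \<longleftrightarrow> cadjoint A = A"

definition unitary :: "complex^'n^'n \<Rightarrow> bool"
  where "unitary U \<longleftrightarrow> cadjoint U ** U = mat 1 \<and> U ** cadjoint U = mat 1"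

definition density_operators :: "(complex^'n^'n) set"
  where "density_operators =
    {\<rho>. hermitian \<rho> \<and> (\<forall>v. 0 \<le> Re (cinner v (\<rho> *v v))) \<and> trace \<rho> = 1}"

definition diag_mat :: "('n \<Rightarrow> real) \<Rightarrow> complex^'n^'n"
  where "diag_mat d = (\<chi> i j. if i = j then complex_of_real (d i) else 0)"

text \<open>
  Functional calculus for Hermitian matrices: apply \<open>f\<close> to the eigenvalues in a unitary
  diagonalization. The value is independent of the diagonalization, and one exists
  by the spectral theorem; see \<open>herm_fun_eq\<close> and \<open>hermitian_diagonalizable\<close> below.
\<close>

definition herm_fun :: "(real \<Rightarrow> real) \<Rightarrow> complex^'n^'n \<Rightarrow> complex^'n^'n"
  where "herm_fun f A = (THE B. \<exists>U d. unitary U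
    \<and> A = U ** diag_mat d ** cadjoint U
    \<and> B = U ** diag_mat (\<lambda>i. f (d i)) ** cadjoint U)"

text \<open>
  On the kernel of \<open>\<rho>\<close> the value \<open>log 2 0 = 0\<close> is irrelevant, being multiplied by the eigenvalue
  \<open>0\<close>; this is the usual convention $0 \log_2 0 = 0$. The trace is real, see \<open>vn_entropy_eq\<close>.
\<close>

definition vn_entropy :: "complex^'n^'n \<Rightarrow> real"
  where "vn_entropy \<rho> = - Re (trace (\<rho> ** herm_fun (log 2) \<rho>))"

definition feasible_states ::
    "(complex^'n^'n) set \<Rightarrow> complex^'n^'n \<Rightarrow> real \<Rightarrow> (complex^'n^'n) set"
  where "feasible_states C A a = {\<rho> \<in> C. trace (\<rho> ** A) = complex_of_real a}"

definition S_max_exists :: "(complex^'n^'n) set \<Rightarrow> complex^'n^'n \<Rightarrow> real \<Rightarrow> bool"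
  where "S_max_exists C A a \<longleftrightarrow>
    (\<exists>\<rho>\<in>feasible_states C A a. \<forall>\<sigma>\<in>feasible_states C A a. vn_entropy \<sigma> \<le> vn_entropy \<rho>)"

definition S_max :: "(complex^'n^'n) set \<Rightarrow> complex^'n^'n \<Rightarrow> real \<Rightarrow> real"
  where "S_max C A a = (GREATEST s. s \<in> vn_entropy ` feasible_states C A a)"

definition Z_PW :: "(complex^'n^'n) set \<Rightarrow> complex^'n^'n \<Rightarrow> real \<Rightarrow> complex^'n^'n \<Rightarrow> real"
  where "Z_PW C A a \<xi> = vn_entropy \<xi> - S_max C A a"


subsection \<open>The functional calculus is well defined\<close>

lemma cadjoint_mult: "cadjoint (A ** B) = cadjoint B ** cadjoint A"
  by (simp add: cadjoint_def matrix_matrix_mult_def vec_eq_iff mult.commute)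

lemma diag_mat_mult_left: "(diag_mat d ** M) $ i $ j = complex_of_real (d i) * M $ i $ j"
  by (simp add: diag_mat_def matrix_matrix_mult_def if_distrib[of "\<lambda>x. x * _"] cong: if_cong)

lemma diag_mat_mult_right: "(M ** diag_mat d) $ i $ j = M $ i $ j * complex_of_real (d j)"
  by (simp add: diag_mat_def matrix_matrix_mult_def if_distrib[of "\<lambda>x. _ * x"] cong: if_cong)

lemma herm_fun_eq:
  assumes U: "unitary U" and A: "A = U ** diag_mat d ** cadjoint U"
  shows "herm_fun f A = U ** diag_mat (\<lambda>i. f (d i)) ** cadjoint U"
  unfolding herm_fun_def
proof (rule the_equality)
  show "\<exists>V e. unitary V \<and> A = V ** diag_mat e ** cadjoint V \<and>
      U ** diag_mat (\<lambda>i. f (d i)) ** cadjoint U = V ** diag_mat (\<lambda>i. f (e i)) ** cadjoint V"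
    using U A by blast
next
  fix B
  assume "\<exists>V e. unitary V \<and> A = V ** diag_mat e ** cadjoint V \<and>
      B = V ** diag_mat (\<lambda>i. f (e i)) ** cadjoint V"
  then obtain V e where V: "unitary V" and AV: "A = V ** diag_mat e ** cadjoint V"
    and B: "B = V ** diag_mat (\<lambda>i. f (e i)) ** cadjoint V" by blast
  define W where "W = cadjoint V ** U"
  have "W ** diag_mat d = cadjoint V ** (U ** diag_mat d ** cadjoint U) ** U"
    using U by (simp add: W_def unitary_def flip: matrix_mul_assoc)
  also have "\<dots> = cadjoint V ** (V ** diag_mat e ** cadjoint V) ** U"
    using A AV by simp
  also have "\<dots> = diag_mat e ** W"
    using V by (simp add: W_def unitary_def matrix_mul_assoc)
  finally have comm: "W ** diag_mat d = diag_mat e ** W" .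
  have fcomm: "W ** diag_mat (\<lambda>i. f (d i)) = diag_mat (\<lambda>i. f (e i)) ** W"
  proof -
    have "W $ i $ j * complex_of_real (f (d j)) = complex_of_real (f (e i)) * W $ i $ j" for i j
    proof -
      have "W $ i $ j * complex_of_real (d j) = complex_of_real (e i) * W $ i $ j"
        using comm by (metis diag_mat_mult_left diag_mat_mult_right)
      then have "W $ i $ j = 0 \<or> d j = e i" by (auto simp: mult.commute)
      then show ?thesis by auto
    qed
    then show ?thesis by (simp add: vec_eq_iff diag_mat_mult_left diag_mat_mult_right)
  qed
  have "B = V ** (diag_mat (\<lambda>i. f (e i)) ** W) ** cadjoint U"
    using U by (simp add: B W_def unitary_def flip: matrix_mul_assoc)
  also have "\<dots> = V ** (W ** diag_mat (\<lambda>i. f (d i))) ** cadjoint U"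
    by (simp add: fcomm)
  also have "\<dots> = U ** diag_mat (\<lambda>i. f (d i)) ** cadjoint U"
    using V by (simp add: W_def unitary_def matrix_mul_assoc)
  finally show "B = U ** diag_mat (\<lambda>i. f (d i)) ** cadjoint U" .
qed

lemma Re_cinner: "Re (cinner v w) = v \<bullet> w"
  by (simp add: cinner_def inner_vec_def inner_complex_def)

lemma cinner_imag: "cinner (\<i> *s v) w = - \<i> * cinner v w"
  by (simp add: cinner_def sum_distrib_left mult.assoc)

lemma cinner_hermitian:
  assumes "hermitian A"
  shows "cinner (A *v v) w = cinner v (A *v w)"
proof -
  have A: "cnj (A $ i $ j) = A $ j $ i" for i j
  proof -
    have "cadjoint A $ j $ i = A $ j $ i" using assms by (simp add: hermitian_def)
    then show ?thesis by (simp add: cadjoint_def)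
  qed
  have "cinner (A *v v) w = (\<Sum>i\<in>UNIV. \<Sum>j\<in>UNIV. A $ j $ i * cnj (v $ j) * w $ i)"
    by (simp add: cinner_def matrix_vector_mult_def sum_distrib_right A)
  also have "\<dots> = (\<Sum>j\<in>UNIV. \<Sum>i\<in>UNIV. A $ j $ i * cnj (v $ j) * w $ i)"
    by (rule sum.swap)
  also have "\<dots> = cinner v (A *v w)"
    by (simp add: cinner_def matrix_vector_mult_def sum_distrib_left mult_ac)
  finally show ?thesis .
qed

text \<open>An eigenvector maximizes the Rayleigh quotient on an invariant subspace.\<close>

lemma hermitian_eigenvector:
  fixes A :: "complex^'n^'n"
  assumes A: "hermitian A" and W: "subspace W" "\<And>w. w \<in> W \<Longrightarrow> A *v w \<in> W"
    and x: "x \<in> W" "x \<noteq> 0"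
  shows "\<exists>u\<in>W. \<exists>\<mu>::real. norm u = 1 \<and> A *v u = \<mu> *\<^sub>R u"
proof -
  have lin: "linear ((*v) A)"
    by (rule linearI) (simp_all add: vec_eq_iff matrix_vector_mult_def distrib_left
        sum.distrib scaleR_sum_right)
  have selfadj: "(A *v v) \<bullet> w = v \<bullet> (A *v w)" for v w
    using cinner_hermitian[OF A] by (metis Re_cinner)
  have "compact (sphere 0 1 \<inter> W)"
    using closed_subspace[OF W(1)] by (simp add: compact_Int_closed)
  moreover have "x /\<^sub>R norm x \<in> sphere 0 1 \<inter> W"
    using x W(1) by (simp add: subspace_scale)
  moreover have "continuous_on (sphere 0 1 \<inter> W) (\<lambda>w. w \<bullet> (A *v w))"
    using lin by (intro continuous_intros linear_continuous_on) (simp add: linear_conv_bounded_linear)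
  ultimately obtain u where u: "u \<in> sphere 0 1 \<inter> W"
    and umax: "\<And>w. w \<in> sphere 0 1 \<inter> W \<Longrightarrow> w \<bullet> (A *v w) \<le> u \<bullet> (A *v u)"
    using continuous_attains_sup[of "sphere 0 1 \<inter> W"] by blast
  define \<mu> where "\<mu> = u \<bullet> (A *v u)"
  define w where "w = \<mu> *\<^sub>R u - A *v u"
  define h where "h v = \<mu> * (v \<bullet> v) - v \<bullet> (A *v v)" for v
  have uu: "u \<bullet> u = 1" using u by (simp add: dot_square_norm)
  have h_nonneg: "0 \<le> h v" if "v \<in> W" for v
  proof (cases "v = 0")
    case False
    have "(v /\<^sub>R norm v) \<bullet> (A *v (v /\<^sub>R norm v)) \<le> \<mu>"
      unfolding \<mu>_def using that False W(1) by (intro umax) (simp add: subspace_scale)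
    then have "(v \<bullet> (A *v v)) / (v \<bullet> v) \<le> \<mu>"
      by (simp add: linear_cmul[OF lin] dot_square_norm power2_eq_square divide_inverse mult_ac)
    then show ?thesis using False by (simp add: h_def field_simps)
  qed (simp add: h_def)
  have wW: "w \<in> W" using u W by (simp add: w_def subspace_diff subspace_scale)
  have expand: "h (u + t *\<^sub>R w) = 2 * t * (w \<bullet> w) + t\<^sup>2 * h w" for t
  proof -
    have comm: "u \<bullet> (A *v w) = (A *v u) \<bullet> w" "w \<bullet> (A *v u) = (A *v u) \<bullet> w" "w \<bullet> u = u \<bullet> w"
      by (simp add: selfadj, simp_all add: inner_commute)
    have "h (u + t *\<^sub>R w) = h u + 2 * t * (\<mu> * (u \<bullet> w) - (A *v u) \<bullet> w) + t\<^sup>2 * h w"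
      by (simp add: h_def linear_add[OF lin] linear_cmul[OF lin] inner_add_left inner_add_right
          comm power2_eq_square algebra_simps)
    moreover have "h u = 0" by (simp add: h_def uu \<mu>_def)
    moreover have "\<mu> * (u \<bullet> w) - (A *v u) \<bullet> w = w \<bullet> w"
      by (simp add: w_def inner_diff_left)
    ultimately show ?thesis by simp
  qed
  have "w \<bullet> w = 0"
  proof (rule ccontr)
    assume ne: "w \<bullet> w \<noteq> 0"
    then have pos: "0 < w \<bullet> w" by (simp add: less_le)
    define t where "t = - (w \<bullet> w) / (h w + 1)"
    have hw: "0 \<le> h w" by (rule h_nonneg[OF wW])
    have tneg: "t < 0" using pos hw by (simp add: t_def divide_neg_pos)
    have "0 \<le> h (u + t *\<^sub>R w)"
      using u wW W(1) by (intro h_nonneg) (simp add: subspace_add subspace_scale)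
    then have "0 \<le> t * (2 * (w \<bullet> w) + t * h w)"
      by (simp add: expand power2_eq_square algebra_simps)
    then have "2 * (w \<bullet> w) + t * h w \<le> 0"
      using tneg by (simp add: zero_le_mult_iff)
    moreover have "- (w \<bullet> w) \<le> t * h w"
      using pos hw by (simp add: t_def field_simps)
    ultimately show False using pos by linarith
  qed
  then have "A *v u = \<mu> *\<^sub>R u" by (simp add: w_def)
  then show ?thesis using u by auto
qed

lemma orthonormal_eigenvectors:
  fixes A :: "complex^'n^'n"
  assumes A: "hermitian A" and "k \<le> CARD('n)"
  shows "\<exists>B. finite B \<and> card B = k \<and> (\<forall>v\<in>B. \<exists>\<mu>::real. A *v v = \<mu> *\<^sub>R v)
    \<and> (\<forall>v\<in>B. \<forall>w\<in>B. cinner v w = (if v = w then 1 else 0))"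
  using assms(2)
proof (induction k)
  case (Suc k)
  then obtain B where B: "finite B" "card B = k" and eig: "\<forall>v\<in>B. \<exists>\<mu>::real. A *v v = \<mu> *\<^sub>R v"
    and orth: "\<forall>v\<in>B. \<forall>w\<in>B. cinner v w = (if v = w then 1 else 0)" by auto
  define W where "W = {w. \<forall>v\<in>B. cinner v w = 0}"
  have W: "subspace W"
    by (auto simp: W_def subspace_def cinner_def distrib_left sum.distrib
        simp flip: scaleR_sum_right)
  have inv: "A *v w \<in> W" if "w \<in> W" for w
  proof -
    have "cinner v (A *v w) = 0" if v: "v \<in> B" for v
    proof -
      obtain \<mu> :: real where "A *v v = \<mu> *\<^sub>R v" using eig v by blast
      then have "cinner v (A *v w) = \<mu> *\<^sub>R cinner v w"
        by (simp add: cinner_hermitian[OF A, symmetric])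
          (simp add: cinner_def scaleR_sum_right)
      then show ?thesis using \<open>w \<in> W\<close> v by (simp add: W_def)
    qed
    then show ?thesis by (simp add: W_def)
  qed
  let ?D = "B \<union> (*s) \<i> ` B"
  have "dim ?D \<le> card ?D" using B by (intro dim_le_card') simp
  also have "\<dots> \<le> card B + card ((*s) \<i> ` B)" by (rule card_Un_le)
  also have "\<dots> \<le> 2 * k" using card_image_le[OF B(1), of "(*s) \<i>"] B(2) by simp
  also have "\<dots> < DIM(complex^'n)" using Suc.prems by simp
  finally obtain x :: "complex^'n" where x: "x \<noteq> 0" "\<And>y. y \<in> span ?D \<Longrightarrow> orthogonal x y"
    using orthogonal_to_subspace_exists by blast
  have "x \<in> W"
    unfolding W_def
  proof safe
    fix v assume v: "v \<in> B"
    have "v \<bullet> x = 0" "(\<i> *s v) \<bullet> x = 0"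
      using x(2)[of v] x(2)[of "\<i> *s v"] v
      by (auto simp: orthogonal_def inner_commute span_base)
    then have "Re (cinner v x) = 0" "Re (cinner (\<i> *s v) x) = 0" by (simp_all add: Re_cinner)
    then show "cinner v x = 0" by (simp add: cinner_imag complex_eq_iff)
  qed
  then obtain u \<mu> where u: "u \<in> W" "norm u = 1" "A *v u = \<mu> *\<^sub>R u"
    using hermitian_eigenvector[OF A W inv _ x(1)] by blast
  have "Re (cinner u u) = 1" "Im (cinner u u) = 0"
    using u(2) by (simp add: Re_cinner dot_square_norm) (simp add: cinner_def)
  then have uu: "cinner u u = 1" by (simp add: complex_eq_iff)
  have vu: "cinner v u = 0" if "v \<in> B" for v using u(1) that by (simp add: W_def)
  have uv: "cinner u v = 0" if "v \<in> B" for v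
  proof -
    have "cinner u v = cnj (cinner v u)" by (simp add: cinner_def mult.commute)
    then show ?thesis by (simp add: vu that)
  qed
  have "u \<notin> B" using vu uu by force
  then have "finite (insert u B)" "card (insert u B) = Suc k" using B by auto
  moreover have "\<forall>v\<in>insert u B. \<exists>\<mu>::real. A *v v = \<mu> *\<^sub>R v" using eig u(3) by blast
  moreover have "\<forall>v\<in>insert u B. \<forall>w\<in>insert u B. cinner v w = (if v = w then 1 else 0)"
    using orth uu uv vu \<open>u \<notin> B\<close> by auto
  ultimately show ?case by blast
qed (auto intro: exI[of _ "{}"])

lemma hermitian_diagonalizable:
  fixes A :: "complex^'n^'n"
  assumes A: "hermitian A"
  shows "\<exists>U d. unitary U \<and> A = U ** diag_mat d ** cadjoint U"
proof -
  obtain B where B: "finite B" "card B = CARD('n)"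
    and eig: "\<forall>v\<in>B. \<exists>\<mu>::real. A *v v = \<mu> *\<^sub>R v"
    and orth: "\<forall>v\<in>B. \<forall>w\<in>B. cinner v w = (if v = w then 1 else 0)"
    using orthonormal_eigenvectors[OF A order_refl] by blast
  obtain b :: "'n \<Rightarrow> complex^'n" where b: "bij_betw b UNIV B"
    using finite_same_card_bij[OF finite B(1)] B(2) by auto
  have bB: "b j \<in> B" for j using b by (auto simp: bij_betw_def)
  have "\<forall>j. \<exists>\<mu>::real. A *v b j = \<mu> *\<^sub>R b j" using eig bB by blast
  then obtain d where d: "A *v b j = d j *\<^sub>R b j" for j using choice by metis
  define U :: "complex^'n^'n" where "U = (\<chi> i j. b j $ i)"
  have "(cadjoint U ** U) $ i $ j = cinner (b i) (b j)" for i j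
    by (simp add: cadjoint_def U_def matrix_matrix_mult_def cinner_def)
  moreover have "cinner (b i) (b j) = (if i = j then 1 else 0)" for i j
    using orth bB b by (simp add: bij_betw_def inj_eq)
  ultimately have UU: "cadjoint U ** U = mat 1" by (simp add: vec_eq_iff mat_def)
  then have UU': "U ** cadjoint U = mat 1" by (simp add: matrix_left_right_inverse)
  have "A ** U = U ** diag_mat d"
  proof -
    have "(A ** U) $ i $ j = (A *v b j) $ i" for i j
      by (simp add: U_def matrix_matrix_mult_def matrix_vector_mult_def)
    then show ?thesis
      by (simp add: vec_eq_iff diag_mat_mult_right d U_def scaleR_conv_of_real[where 'a = complex] mult.commute)
  qed
  then have "U ** diag_mat d ** cadjoint U = A"
    using UU' by (metis matrix_mul_assoc matrix_mul_rid)
  then show ?thesis using UU UU' unitary_def by metis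
qed

lemma vn_entropy_eq:
  assumes U: "unitary U" and \<rho>: "\<rho> = U ** diag_mat d ** cadjoint U"
  shows "trace (\<rho> ** herm_fun (log 2) \<rho>) = complex_of_real (\<Sum>i\<in>UNIV. d i * log 2 (d i))"
    and "vn_entropy \<rho> = - (\<Sum>i\<in>UNIV. d i * log 2 (d i))"
proof -
  have "\<rho> ** herm_fun (log 2) \<rho> = U ** diag_mat d ** (cadjoint U ** U)
      ** diag_mat (\<lambda>i. log 2 (d i)) ** cadjoint U"
    unfolding herm_fun_eq[OF U \<rho>] by (subst \<rho>) (simp add: matrix_mul_assoc)
  also have "\<dots> = U ** (diag_mat d ** diag_mat (\<lambda>i. log 2 (d i)) ** cadjoint U)"
    using U by (simp add: unitary_def matrix_mul_assoc)
  finally have "\<rho> ** herm_fun (log 2) \<rho>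
      = U ** (diag_mat d ** diag_mat (\<lambda>i. log 2 (d i)) ** cadjoint U)" .
  then have "trace (\<rho> ** herm_fun (log 2) \<rho>)
      = trace (diag_mat d ** diag_mat (\<lambda>i. log 2 (d i)) ** cadjoint U ** U)"
    using trace_mul_sym by metis
  also have "\<dots> = trace (diag_mat d ** diag_mat (\<lambda>i. log 2 (d i)))"
    using U by (simp add: unitary_def flip: matrix_mul_assoc)
  also have "\<dots> = complex_of_real (\<Sum>i\<in>UNIV. d i * log 2 (d i))"
    by (simp add: trace_def diag_mat_mult_left) (simp add: diag_mat_def)
  finally show *: "trace (\<rho> ** herm_fun (log 2) \<rho>)
      = complex_of_real (\<Sum>i\<in>UNIV. d i * log 2 (d i))" .
  show "vn_entropy \<rho> = - (\<Sum>i\<in>UNIV. d i * log 2 (d i))"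
    by (simp add: vn_entropy_def *)
qed

end

theory Submission
  imports Defs
begin

text \<open>Contraposition: if \<xi> lacked the property, it would lie in \<open>C\<close> and,
  having the prescribed expectation value, would itself compete in the maximum defining
  \<open>S_max\<close>. Its entropy could then not exceed \<open>S_max\<close>, so
  \<open>Z_PW\<close> could not be positive. The bound on competitors is
  \<open>vn_entropy_le_S_max\<close>.\<close>

lemma vn_entropy_le_S_max:
  assumes "S_max_exists C A a" and "\<rho> \<in> feasible_states C A a"
  shows "vn_entropy \<rho> \<le> S_max C A a"
proof -
  obtain \<sigma> where "\<sigma> \<in> feasible_states C A a"
    and max: "\<And>\<tau>. \<tau> \<in> feasible_states C A a \<Longrightarrow> vn_entropy \<tau> \<le> vn_entropy \<sigma>"
    using assms(1) unfolding S_max_exists_def by blast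
  \<comment> \<open>\<open>GREATEST\<close> is a definite description, so it denotes the maximum
    only once one is known to be attained; the maximizer \<sigma> provides this.\<close>
  then have "S_max C A a = vn_entropy \<sigma>"
    unfolding S_max_def by (intro Greatest_equality) auto
  then show ?thesis
    using max assms(2) by simp
qed

theorem corollary3:
  fixes P :: "complex^('a::finite \<times> 'b::finite)^('a \<times> 'b) \<Rightarrow> bool"
    and C :: "(complex^('a \<times> 'b)^('a \<times> 'b)) set"
    and A \<xi> :: "complex^('a \<times> 'b)^('a \<times> 'b)"
    and A' :: real
  assumes "C = {\<rho> \<in> density_operators. \<not> P \<rho>}"
    and "hermitian A"
    and "S_max_exists C A A'"
    and "\<xi> \<in> density_operators"
    and "trace (\<xi> ** A) = complex_of_real A'"
    and "Z_PW C A A' \<xi> > 0"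
  shows "P \<xi>"
proof (rule ccontr)
  assume "\<not> P \<xi>"
  then have "\<xi> \<in> feasible_states C A A'"
    using assms(1,4,5) by (simp add: feasible_states_def)
  then have "vn_entropy \<xi> \<le> S_max C A A'"
    by (rule vn_entropy_le_S_max[OF assms(3)])
  then show False
    using assms(6) by (simp add: Z_PW_def)
qed

end
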